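(* Let $G$ be a connected graph with at least one edge. Then $$\inf_{\omega\in W} t_\omega(G)=\min_{S\in Co(G)}\frac{|S|-1}{e(G[S])},$$ where $Co(G)=\{S\subseteq V(G)\,:\, G[S]\text{ is connected}\}$.
   Context: Graphs are finite, simple and undirected. $G[S]$ is the subgraph induced by $S$ and $e(H)$ is the number of edges of $H$. Let $W$ be the set of functions $\omega:E(G)\to\mathbb{R}_{\ge 0}$ that are not identically zero. Write $\omega(H)=\sum_{e\in E(H)}\omega(e)$ and $\omega(G)=\sum_{e\in E(G)}\omega(e)$. Let $T_\omega$ be a maximum spanning tree of $G$ with respect to $\omega$, i.e. a spanning tree maximizing $\omega(T)$. The weighting ratio is $t_\omega(G)=\omega(T_\omega)/\omega(G)$. In the minimum over $Co(G)$ only sets $S$ with $|S|\ge 2$ are considered, since otherwise the quotient is $0/0$. *)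

theory Defs
  imports Complex_Main
begin

record 'a ugraph =
  verts :: "'a set"
  edges :: "'a set set"

definition simple_graph :: "'a ugraph \<Rightarrow> bool" where
  "simple_graph G \<longleftrightarrow> finite (verts G) \<and> (\<forall>e\<in>edges G. e \<subseteq> verts G \<and> card e = 2)"

definition adj :: "'a ugraph \<Rightarrow> 'a rel" where
  "adj G = {(u, v). {u, v} \<in> edges G}"

definition connected_graph :: "'a ugraph \<Rightarrow> bool" where
  "connected_graph G \<longleftrightarrow> verts G \<noteq> {} \<and> (\<forall>u\<in>verts G. \<forall>v\<in>verts G. (u, v) \<in> (adj G)\<^sup>*)"

text \<open>A cycle is given by its cyclic sequence of distinct vertices, without repeating the first one.\<close>

definition is_cycle :: "'a ugraph \<Rightarrow> 'a list \<Rightarrow> bool" where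
  "is_cycle G vs \<longleftrightarrow> 3 \<le> length vs \<and> distinct vs \<and>
     (\<forall>i<length vs. (vs ! i, vs ! (Suc i mod length vs)) \<in> adj G)"

definition is_tree :: "'a ugraph \<Rightarrow> bool" where
  "is_tree T \<longleftrightarrow> simple_graph T \<and> connected_graph T \<and> (\<nexists>vs. is_cycle T vs)"

definition is_spanning_tree :: "'a ugraph \<Rightarrow> 'a ugraph \<Rightarrow> bool" where
  "is_spanning_tree G T \<longleftrightarrow> is_tree T \<and> verts T = verts G \<and> edges T \<subseteq> edges G"

definition induced :: "'a ugraph \<Rightarrow> 'a set \<Rightarrow> 'a ugraph" where
  "induced G S = \<lparr>verts = S, edges = {e \<in> edges G. e \<subseteq> S}\<rparr>"

definition num_edges :: "'a ugraph \<Rightarrow> nat" where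
  "num_edges H = card (edges H)"

text \<open>Weights are total functions on vertex sets; only their values on \<^term>\<open>edges G\<close> matter.\<close>

definition weightings :: "'a ugraph \<Rightarrow> ('a set \<Rightarrow> real) set" where
  "weightings G = {\<omega>. (\<forall>e\<in>edges G. 0 \<le> \<omega> e) \<and> (\<exists>e\<in>edges G. \<omega> e \<noteq> 0)}"

definition weight :: "('a set \<Rightarrow> real) \<Rightarrow> 'a ugraph \<Rightarrow> real" where
  "weight \<omega> H = (\<Sum>e\<in>edges H. \<omega> e)"

definition is_max_spanning_tree :: "'a ugraph \<Rightarrow> ('a set \<Rightarrow> real) \<Rightarrow> 'a ugraph \<Rightarrow> bool" where
  "is_max_spanning_tree G \<omega> T \<longleftrightarrow> is_spanning_tree G T \<and>
     (\<forall>T'. is_spanning_tree G T' \<longrightarrow> weight \<omega> T' \<le> weight \<omega> T)"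

text \<open>All maximum spanning trees have the same weight, so the choice below does not affect the
  weighting ratio.\<close>

definition max_spanning_tree :: "'a ugraph \<Rightarrow> ('a set \<Rightarrow> real) \<Rightarrow> 'a ugraph" where
  "max_spanning_tree G \<omega> = (SOME T. is_max_spanning_tree G \<omega> T)"

definition weighting_ratio :: "'a ugraph \<Rightarrow> ('a set \<Rightarrow> real) \<Rightarrow> real" where
  "weighting_ratio G \<omega> = weight \<omega> (max_spanning_tree G \<omega>) / weight \<omega> G"

definition Co :: "'a ugraph \<Rightarrow> 'a set set" where
  "Co G = {S. S \<subseteq> verts G \<and> connected_graph (induced G S)}"

end

theory Submission
  imports
    Defs
    "HOL-Library.Disjoint_Sets"
    "HOL-Library.Ramsey"
    "HOL-Library.Transitive_Closure_Table"
begin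

text \<open>For a minimizing set \<open>S\<close>, the weighting that is 1 on the edges inside \<open>S\<close> and 0 elsewhere gives
  the upper bound, since a spanning tree restricted to \<open>S\<close> is a forest and so has at most \<open>|S| - 1\<close>
  edges. For the lower bound, Kruskal's algorithm yields a spanning tree \<open>T\<close> such that, for every
  threshold \<open>s\<close>, the edges of weight at least \<open>s\<close> have the same components in \<open>T\<close> as in \<open>G\<close>. If there
  are \<open>c\<close> components, then \<open>T\<close> has at least \<open>|V| - c\<close> such edges, while \<open>G\<close>, counted component by
  component, has at most \<open>(|V| - c) / m\<close>, where \<open>m\<close> is the minimum over connected sets. Summation by
  parts over the thresholds turns these cardinality bounds into \<open>\<omega> T \<ge> m \<sdot> \<omega> G\<close>.\<close>

subsection \<open>Reachability and components\<close>

definition reachable :: "'a set set \<Rightarrow> 'a rel" where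
  "reachable A = {(u, v). {u, v} \<in> A}\<^sup>*"

lemma reachable_refl [simp]: "(u, u) \<in> reachable A"
  by (simp add: reachable_def)

lemma edge_reachable: "{u, v} \<in> A \<Longrightarrow> (u, v) \<in> reachable A"
  by (auto simp: reachable_def)

lemma reachable_mono: "A \<subseteq> B \<Longrightarrow> reachable A \<subseteq> reachable B"
  unfolding reachable_def by (rule rtrancl_mono) auto

lemma reachable_sym:
  assumes "(u, v) \<in> reachable A"
  shows "(v, u) \<in> reachable A"
proof -
  have "sym {(u, v). {u, v} \<in> A}"
    by (auto simp: sym_def insert_commute)
  with assms show ?thesis
    unfolding reachable_def by (meson sym_rtrancl symD)
qed

lemma reachable_trans:
  "(u, v) \<in> reachable A \<Longrightarrow> (v, w) \<in> reachable A \<Longrightarrow> (u, w) \<in> reachable A"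
  unfolding reachable_def by (rule rtrancl_trans)

lemma equiv_reachable: "equiv UNIV (reachable A)"
proof (rule equivI)
  show "refl_on UNIV (reachable A)"
    by (simp add: refl_on_def)
  show "sym (reachable A)"
    by (rule symI) (rule reachable_sym)
  show "trans (reachable A)"
    by (rule transI) (rule reachable_trans)
qed simp

lemma reachable_Image_eq_iff:
  "reachable A `` {u} = reachable A `` {v} \<longleftrightarrow> (u, v) \<in> reachable A"
  by (rule eq_equiv_class_iff[OF equiv_reachable UNIV_I UNIV_I])

lemma reachable_empty: "reachable {} = Id"
  by (simp add: reachable_def)

lemma reachable_insert_iff:
  "(x, y) \<in> reachable (insert {u, v} A) \<longleftrightarrow> (x, y) \<in> reachable A \<or>
     (x, u) \<in> reachable A \<and> (v, y) \<in> reachable A \<or> (x, v) \<in> reachable A \<and> (u, y) \<in> reachable A"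
    (is "_ \<longleftrightarrow> ?via x y")
proof
  assume "(x, y) \<in> reachable (insert {u, v} A)"
  then show "?via x y"
    unfolding reachable_def
  proof (induction rule: rtrancl_induct)
    case base
    then show ?case by simp
  next
    case (step y z)
    have "{y, z} \<in> A \<or> y = u \<and> z = v \<or> y = v \<and> z = u"
      using step.hyps(2) by (auto simp: doubleton_eq_iff)
    with step.IH show ?case
      by (auto intro: rtrancl.rtrancl_into_rtrancl)
  qed
next
  assume "?via x y"
  moreover have "reachable A \<subseteq> reachable (insert {u, v} A)"
    by (rule reachable_mono) auto
  moreover have "(u, v) \<in> reachable (insert {u, v} A)" "(v, u) \<in> reachable (insert {u, v} A)"
    by (auto intro: edge_reachable reachable_sym)
  ultimately show "(x, y) \<in> reachable (insert {u, v} A)"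
    by (meson reachable_trans subsetD)
qed

lemma reachable_insert_cong:
  "reachable A = reachable B \<Longrightarrow> reachable (insert {u, v} A) = reachable (insert {u, v} B)"
  by (auto simp: reachable_insert_iff)

lemma reachable_insert_absorb:
  "(u, v) \<in> reachable A \<Longrightarrow> reachable (insert {u, v} A) = reachable A"
  by (auto simp: reachable_insert_iff) (meson reachable_sym reachable_trans)+

lemma reachable_exchange:
  assumes "(x, y) \<in> reachable (insert {u, v} A)" "(x, y) \<notin> reachable A"
  shows "(u, v) \<in> reachable (insert {x, y} A)"
  using assms by (auto simp: reachable_insert_iff intro: reachable_sym)

lemma reachable_in_vertices:
  assumes "A \<subseteq> [V]\<^bsup>2\<^esup>" "(u, v) \<in> reachable A" "u \<in> V"
  shows "v \<in> V"
  using assms(2,3) unfolding reachable_def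
  by (induction rule: rtrancl_induct) (use assms(1) in auto)

lemma partition_on_quotient_reachable:
  assumes "A \<subseteq> [V]\<^bsup>2\<^esup>"
  shows "partition_on V (V // reachable A)"
proof (rule partition_onI)
  show "\<Union>(V // reachable A) = V"
    using reachable_in_vertices[OF assms] by (force simp: quotient_def)
next
  fix C D assume "C \<in> V // reachable A" "D \<in> V // reachable A" "C \<noteq> D"
  moreover have "V // reachable A \<subseteq> UNIV // reachable A"
    by (auto simp: quotient_def)
  ultimately show "disjnt C D"
    unfolding disjnt_def using quotient_disj[OF equiv_reachable] by blast
next
  show "{} \<notin> V // reachable A"
    using reachable_refl by (fastforce elim: quotientE)
qed

lemma finite_quotient_reachable: "finite V \<Longrightarrow> finite (V // reachable A)"
  by (simp add: quotient_def)

lemma reachable_within_component: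
  assumes C: "C \<in> V // reachable A" and "u \<in> C" "v \<in> C"
  shows "(u, v) \<in> reachable {e \<in> A. e \<subseteq> C}"
proof -
  obtain x where x: "C = reachable A `` {x}" using C by (rule quotientE)
  have "(x, y) \<in> reachable {e \<in> A. e \<subseteq> C}" if "(x, y) \<in> reachable A" for y
    using that[unfolded reachable_def]
  proof (induction rule: rtrancl_induct)
    case base
    show ?case by simp
  next
    case (step y z)
    then have "(x, y) \<in> reachable A" "(y, z) \<in> reachable A"
      by (auto simp: reachable_def)
    then have "{y, z} \<subseteq> C"
      using x by (auto intro: reachable_trans)
    with step show ?case
      by (blast intro: edge_reachable reachable_trans)
  qed
  with assms(2,3) x show ?thesis
    by (blast intro: reachable_sym reachable_trans)
qed

lemma reachable_insert_Image:
  "reachable (insert {u, v} A) `` {x} =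
     (if (u, x) \<in> reachable A \<or> (v, x) \<in> reachable A
      then reachable A `` {u} \<union> reachable A `` {v} else reachable A `` {x})"
  by (auto simp: reachable_insert_iff) (meson reachable_sym reachable_trans)+

lemma quotient_reachable_insert:
  assumes "u \<in> V" "v \<in> V"
  shows "V // reachable (insert {u, v} A) =
    insert (reachable A `` {u} \<union> reachable A `` {v})
      (V // reachable A - {reachable A `` {u}, reachable A `` {v}})"
    (is "?Q' = insert ?M (?Q - {?U, ?W})")
proof -
  let ?cls = "\<lambda>x. reachable (insert {u, v} A) `` {x}"
  let ?X = "{x \<in> V. (u, x) \<notin> reachable A \<and> (v, x) \<notin> reachable A}"
  have "?Q' = ?cls ` (V - ?X) \<union> ?cls ` ?X"
    by (auto simp: quotient_def)
  also have "?cls ` (V - ?X) = (\<lambda>x. ?M) ` (V - ?X)"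
    by (intro image_cong) (auto simp: reachable_insert_Image)
  also have "\<dots> = {?M}"
    using assms(1) reachable_refl[of u A] by blast
  also have "?cls ` ?X = (\<lambda>x. reachable A `` {x}) ` ?X"
    by (intro image_cong) (auto simp: reachable_insert_Image)
  also have "?X = {x \<in> V. reachable A `` {x} \<notin> {?U, ?W}}"
    by (auto simp: reachable_Image_eq_iff intro: reachable_sym)
  also have "(\<lambda>x. reachable A `` {x}) ` \<dots> = ?Q - {?U, ?W}"
    unfolding quotient_def by blast
  finally show ?thesis by simp
qed

lemma card_quotient_reachable_insert:
  assumes V: "finite V" "u \<in> V" "v \<in> V" and uv: "(u, v) \<notin> reachable A"
  shows "Suc (card (V // reachable (insert {u, v} A))) = card (V // reachable A)"
proof -
  let ?Q = "V // reachable A" and ?U = "reachable A `` {u}" and ?W = "reachable A `` {v}"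
  have UW: "?U \<in> ?Q" "?W \<in> ?Q" using V by (auto intro: quotientI)
  have "?U \<noteq> ?W" using uv by (simp add: reachable_Image_eq_iff)
  have new: "?U \<union> ?W \<notin> ?Q"
  proof
    assume "?U \<union> ?W \<in> ?Q"
    then obtain x where x: "?U \<union> ?W = reachable A `` {x}" by (rule quotientE)
    have "u \<in> ?U \<union> ?W" "v \<in> ?U \<union> ?W" by simp_all
    then have "(x, u) \<in> reachable A" "(x, v) \<in> reachable A"
      unfolding x by simp_all
    with uv show False by (meson reachable_sym reachable_trans)
  qed
  have fin: "finite ?Q" using V(1) by (rule finite_quotient_reachable)
  have "card (V // reachable (insert {u, v} A)) = Suc (card (?Q - {?U, ?W}))"
    unfolding quotient_reachable_insert[OF V(2,3)] using fin new by simp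
  moreover have "card ?Q = Suc (Suc (card (?Q - {?U, ?W})))"
    using fin UW \<open>?U \<noteq> ?W\<close>
    by (metis Diff_insert2 card_Suc_Diff1 finite_Diff insertE insert_Diff)
  ultimately show ?thesis by simp
qed

lemma card_quotient_reachable_empty: "card (V // reachable {}) = card V"
  by (simp add: reachable_empty quotient_def UNION_singleton_eq_range card_image)

lemma card_vertices_le_edges_plus_components:
  assumes "finite V" "A \<subseteq> [V]\<^bsup>2\<^esup>"
  shows "card V \<le> card A + card (V // reachable A)"
proof -
  have "finite A"
    using assms(2) finite_imp_finite_nsets[OF assms(1)] by (rule finite_subset)
  then show ?thesis using assms(2)
  proof (induction rule: finite_induct)
    case empty
    show ?case by (simp add: card_quotient_reachable_empty)
  next
    case (insert e A)
    then obtain u v where e: "e = {u, v}" "u \<in> V" "v \<in> V" by (auto elim: nsets2_E)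
    have "card (V // reachable A) \<le> Suc (card (V // reachable (insert e A)))"
      using card_quotient_reachable_insert[OF assms(1) e(2,3), of A] e(1)
      by (cases "(u, v) \<in> reachable A") (auto simp: reachable_insert_absorb)
    with insert show ?case by simp
  qed
qed

subsection \<open>Forests\<close>

definition forest :: "'a set set \<Rightarrow> bool" where
  "forest A \<longleftrightarrow> (\<forall>u v. {u, v} \<in> A \<longrightarrow> (u, v) \<notin> reachable (A - {{u, v}}))"

lemma forest_empty: "forest {}"
  by (simp add: forest_def)

lemma forest_subset: "forest A \<Longrightarrow> B \<subseteq> A \<Longrightarrow> forest B"
  unfolding forest_def using reachable_mono[OF Diff_mono] by blast

lemma forest_insert:
  assumes A: "forest A" and uv: "(u, v) \<notin> reachable A"
  shows "forest (insert {u, v} A)"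
  unfolding forest_def
proof (intro allI impI)
  fix x y assume xy: "{x, y} \<in> insert {u, v} A"
  have notin: "{u, v} \<notin> A" using uv by (auto dest: edge_reachable)
  show "(x, y) \<notin> reachable (insert {u, v} A - {{x, y}})"
  proof (cases "{x, y} = {u, v}")
    case True
    then have "(x, y) \<notin> reachable A"
      using uv reachable_sym by (metis doubleton_eq_iff)
    with True notin show ?thesis by simp
  next
    case False
    with xy have "{x, y} \<in> A" by simp
    then have "insert {x, y} (A - {{x, y}}) = A" "(x, y) \<notin> reachable (A - {{x, y}})"
      using A by (auto simp: forest_def)
    with uv have "(x, y) \<notin> reachable (insert {u, v} (A - {{x, y}}))"
      using reachable_exchange by metis
    with False show ?thesis by (simp add: insert_Diff_if)
  qed
qed

lemma forest_card_vertices_eq: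
  assumes "finite V" "A \<subseteq> [V]\<^bsup>2\<^esup>" "forest A"
  shows "card V = card A + card (V // reachable A)"
proof -
  have "finite A"
    using assms(2) finite_imp_finite_nsets[OF assms(1)] by (rule finite_subset)
  then show ?thesis using assms(2,3)
  proof (induction rule: finite_induct)
    case empty
    show ?case by (simp add: card_quotient_reachable_empty)
  next
    case (insert e A)
    then obtain u v where e: "e = {u, v}" "u \<in> V" "v \<in> V" by (auto elim: nsets2_E)
    have "(u, v) \<notin> reachable A"
      using insert.prems(2) insert.hyps(2) e(1) by (auto simp: forest_def)
    then have "Suc (card (V // reachable (insert e A))) = card (V // reachable A)"
      unfolding e(1) by (rule card_quotient_reachable_insert[OF assms(1) e(2,3)])
    moreover have "card V = card A + card (V // reachable A)"
      using insert.prems by (intro insert.IH) (auto intro: forest_subset)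
    ultimately show ?case using insert.hyps by simp
  qed
qed

corollary forest_card_less:
  assumes "finite V" "V \<noteq> {}" "A \<subseteq> [V]\<^bsup>2\<^esup>" "forest A"
  shows "card A < card V"
proof -
  have "0 < card (V // reachable A)"
    using assms(1,2) by (simp add: card_gt_0_iff finite_quotient_reachable)
  with forest_card_vertices_eq[OF assms(1,3,4)] show ?thesis by simp
qed

subsection \<open>Simple graphs and trees\<close>

lemma simple_graph_iff: "simple_graph G \<longleftrightarrow> finite (verts G) \<and> edges G \<subseteq> [verts G]\<^bsup>2\<^esup>"
  by (auto simp: simple_graph_def nsets_def intro: finite_subset)

lemma simple_graph_finite_edges: "simple_graph G \<Longrightarrow> finite (edges G)"
  unfolding simple_graph_iff using finite_imp_finite_nsets finite_subset by blast

lemma connected_graph_iff_reachable: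
  "connected_graph G \<longleftrightarrow>
     verts G \<noteq> {} \<and> (\<forall>u\<in>verts G. \<forall>v\<in>verts G. (u, v) \<in> reachable (edges G))"
  by (simp add: connected_graph_def adj_def reachable_def)

lemma is_cycle_closed_path:
  assumes path: "rtrancl_path (\<lambda>x y. {x, y} \<in> edges G) u xs v" and "distinct (u # xs)"
    and len: "2 \<le> length xs" and closing: "{v, u} \<in> edges G"
  shows "is_cycle G (u # xs)"
proof -
  have "xs \<noteq> []" using len by auto
  with path have last: "last xs = v" by (rule rtrancl_path_last)
  have "((u # xs) ! i, (u # xs) ! (Suc i mod length (u # xs))) \<in> adj G"
    if "i < length (u # xs)" for i
  proof (cases "i = length xs")
    case True
    with last \<open>xs \<noteq> []\<close> closing show ?thesis
      by (simp add: adj_def nth_Cons' last_conv_nth)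
  next
    case False
    with that have "i < length xs" by simp
    with rtrancl_path_nth[OF path this] show ?thesis by (simp add: adj_def)
  qed
  with assms(2) len show ?thesis by (simp add: is_cycle_def)
qed

lemma acyclic_imp_forest:
  assumes G: "simple_graph G" and acyclic: "\<nexists>vs. is_cycle G vs"
  shows "forest (edges G)"
  unfolding forest_def
proof (intro allI impI notI)
  fix u v assume uv: "{u, v} \<in> edges G"
    and detour: "(u, v) \<in> reachable (edges G - {{u, v}})"
  let ?r = "\<lambda>x y. {x, y} \<in> edges G - {{u, v}}"
  have "?r\<^sup>*\<^sup>* u v"
    using detour by (simp add: reachable_def rtranclp_rtrancl_eq)
  then obtain xs where path: "rtrancl_path ?r u xs v" and dist: "distinct (u # xs)"
    unfolding rtranclp_eq_rtrancl_path by (auto elim: rtrancl_path_distinct)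
  have "u \<noteq> v"
    using G uv unfolding simple_graph_iff by (metis doubleton_in_nsets_2 subsetD)
  then have "xs \<noteq> []" using path by (auto elim: rtrancl_path.cases)
  moreover have "length xs \<noteq> 1"
  proof
    assume "length xs = 1"
    then have "xs = [v]"
      using rtrancl_path_last[OF path \<open>xs \<noteq> []\<close>] by (auto simp: length_Suc_conv)
    with rtrancl_path_nth[OF path, of 0] show False by simp
  qed
  ultimately have "2 \<le> length xs" by (cases "length xs") auto
  moreover have "rtrancl_path (\<lambda>x y. {x, y} \<in> edges G) u xs v"
    using path by (rule rtrancl_path_mono) simp
  ultimately have "is_cycle G (u # xs)"
    using dist uv by (intro is_cycle_closed_path) (simp_all add: insert_commute)
  with acyclic show False by blast
qed

lemma forest_imp_acyclic:
  assumes "forest (edges G)"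
  shows "\<not> is_cycle G vs"
proof
  assume cycle: "is_cycle G vs"
  define n where "n = length vs - 1"
  have n: "2 \<le> n" "length vs = Suc n" and dist: "distinct vs"
    using cycle by (auto simp: is_cycle_def n_def)
  have consecutive: "{vs ! i, vs ! (Suc i mod Suc n)} \<in> edges G" if "i \<le> n" for i
    using cycle that n(2) by (simp add: is_cycle_def adj_def)
  let ?e = "{vs ! 0, vs ! n}"
  have e: "?e \<in> edges G"
    using consecutive[of n] by (simp add: insert_commute)
  have "{vs ! i, vs ! Suc i} \<in> edges G - {?e}" if "i < n" for i
  proof -
    have "{vs ! i, vs ! Suc i} \<noteq> ?e"
      using that n nth_eq_iff_index_eq[OF dist] by (auto simp: doubleton_eq_iff)
    with consecutive[of i] that show ?thesis by simp
  qed
  then have "(vs ! 0, vs ! n) \<in> {(u, v). {u, v} \<in> edges G - {?e}} ^^ n"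
    unfolding relpow_fun_conv by (intro exI[of _ "(!) vs"]) auto
  then have "(vs ! 0, vs ! n) \<in> reachable (edges G - {?e})"
    unfolding reachable_def by (rule relpow_imp_rtrancl)
  with e assms show False by (auto simp: forest_def)
qed

lemma is_tree_iff_forest:
  "is_tree T \<longleftrightarrow> simple_graph T \<and> connected_graph T \<and> forest (edges T)"
  using acyclic_imp_forest forest_imp_acyclic by (auto simp: is_tree_def)

lemma is_spanning_tree_card_less:
  assumes T: "is_spanning_tree G T" and S: "finite S" "S \<noteq> {}"
  shows "card {e \<in> edges T. e \<subseteq> S} < card S"
proof (rule forest_card_less[OF S])
  have "simple_graph T" "forest (edges T)"
    using T by (simp_all add: is_spanning_tree_def is_tree_iff_forest)
  then show "{e \<in> edges T. e \<subseteq> S} \<subseteq> [S]\<^bsup>2\<^esup>" "forest {e \<in> edges T. e \<subseteq> S}"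
    by (auto simp: simple_graph_iff nsets_def intro: forest_subset)
qed

subsection \<open>Kruskal's algorithm\<close>

definition superlevel :: "('b \<Rightarrow> 'c::ord) \<Rightarrow> 'c \<Rightarrow> 'b set \<Rightarrow> 'b set" where
  "superlevel f s A = {x \<in> A. s \<le> f x}"

lemma superlevel_subset: "superlevel f s A \<subseteq> A"
  by (auto simp: superlevel_def)

lemma superlevel_all: "(\<And>x. x \<in> A \<Longrightarrow> s \<le> f x) \<Longrightarrow> superlevel f s A = A"
  by (auto simp: superlevel_def)

lemma superlevel_insert:
  "superlevel f s (insert x A) = (if s \<le> f x then insert x (superlevel f s A) else superlevel f s A)"
  by (auto simp: superlevel_def)

lemma exists_kruskal_forest:
  fixes \<omega> :: "'a set \<Rightarrow> 'b::linordered_ab_group_add"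
  assumes "finite F" "F \<subseteq> [V]\<^bsup>2\<^esup>"
  shows "\<exists>B\<subseteq>F. forest B \<and>
    (\<forall>s. reachable (superlevel \<omega> s B) = reachable (superlevel \<omega> s F))"
  using assms
proof (induction rule: finite_ranking_induct[where f = "\<lambda>e. - \<omega> e"])
  case empty
  show ?case by (auto simp: forest_empty)
next
  case (insert e F)
  then obtain B where B: "B \<subseteq> F" "forest B"
    "\<And>s. reachable (superlevel \<omega> s B) = reachable (superlevel \<omega> s F)" by auto
  have lightest: "\<omega> e \<le> \<omega> x" if "x \<in> F" for x using insert.hyps(2) that by simp
  obtain u v where e: "e = {u, v}" using insert.prems by (auto elim: nsets2_E)
  define B' where "B' = (if (u, v) \<in> reachable B then B else insert e B)"
  have B': "B \<subseteq> B'" "B' \<subseteq> insert e B" by (auto simp: B'_def)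
  have "forest B'" using forest_insert[OF B(2)] B(2) e by (simp add: B'_def)
  moreover have "reachable (superlevel \<omega> s B') = reachable (superlevel \<omega> s (insert e F))" for s
  proof (cases "s \<le> \<omega> e")
    case True
    then have below: "s \<le> \<omega> x" if "x \<in> insert e F" for x
      using lightest that by force
    have full: "superlevel \<omega> s B = B" "superlevel \<omega> s F = F"
      "superlevel \<omega> s B' = B'" "superlevel \<omega> s (insert e F) = insert e F"
      using B(1) B' by (auto intro!: superlevel_all below)
    then have "reachable B = reachable F"
      using B(3)[of s] by simp
    moreover have "reachable B' = reachable (insert e B)"
      by (simp add: B'_def e reachable_insert_absorb)
    ultimately have "reachable B' = reachable (insert e F)"
      using reachable_insert_cong e by metis
    then show ?thesis by (simp add: full)
  next
    case False
    then show ?thesis using B(3) by (simp add: B'_def superlevel_insert)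
  qed
  moreover have "B' \<subseteq> insert e F" using B' B(1) by blast
  ultimately show ?case by (intro exI[of _ B']) simp
qed

lemma exists_kruskal_tree:
  fixes \<omega> :: "'a set \<Rightarrow> 'b::linordered_ab_group_add"
  assumes G: "simple_graph G" "connected_graph G"
  obtains T where "is_spanning_tree G T"
    "\<And>s. reachable (superlevel \<omega> s (edges T)) = reachable (superlevel \<omega> s (edges G))"
proof -
  have finE: "finite (edges G)" using G(1) by (rule simple_graph_finite_edges)
  obtain B where B: "B \<subseteq> edges G" "forest B"
    and levels: "\<And>s. reachable (superlevel \<omega> s B) = reachable (superlevel \<omega> s (edges G))"
    using exists_kruskal_forest[OF finE] G(1) unfolding simple_graph_iff by metis
  let ?T = "\<lparr>verts = verts G, edges = B\<rparr>"
  obtain s where "\<And>e. e \<in> edges G \<Longrightarrow> s \<le> \<omega> e"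
    using finE by (metis Min_le finite_imageI imageI)
  then have "superlevel \<omega> s B = B" "superlevel \<omega> s (edges G) = edges G"
    using B(1) by (auto intro!: superlevel_all)
  with levels[of s] have "connected_graph ?T"
    using G(2) by (simp add: connected_graph_iff_reachable)
  then have "is_spanning_tree G ?T"
    using G(1) B by (auto simp: is_spanning_tree_def is_tree_iff_forest simple_graph_iff)
  with levels show thesis by (intro that[of ?T]) simp_all
qed

subsection \<open>Comparing weights through superlevel sets\<close>

lemma sum_mult_diff_nonneg_of_superlevel:
  fixes f c :: "'b \<Rightarrow> 'c::linordered_idom"
  assumes "finite A" "\<And>x. x \<in> A \<Longrightarrow> t \<le> f x" "\<And>s. t < s \<Longrightarrow> 0 \<le> sum c (superlevel f s A)"
  shows "0 \<le> (\<Sum>x\<in>A. c x * (f x - t))"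
  using assms
proof (induction arbitrary: t rule: finite_ranking_induct[where f = "\<lambda>x. - f x"])
  case empty
  show ?case by simp
next
  case (insert a A)
  have least: "f a \<le> f x" if "x \<in> insert a A" for x
    using insert.hyps(2) that by auto
  have "t \<le> f a" using insert.prems(1) by simp
  have "0 \<le> (\<Sum>x\<in>A. c x * (f x - f a))"
  proof (rule insert.IH)
    show "0 \<le> sum c (superlevel f s A)" if "f a < s" for s
      using insert.prems(2)[of s] that \<open>t \<le> f a\<close> by (simp add: superlevel_insert)
  qed (use least in simp)
  also have "\<dots> = (\<Sum>x\<in>insert a A. c x * (f x - f a))"
    using insert.hyps(1) by (intro sum.mono_neutral_left) auto
  finally have above: "0 \<le> (\<Sum>x\<in>insert a A. c x * (f x - f a))" .
  have below: "0 \<le> sum c (insert a A) * (f a - t)"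
  proof (cases "t = f a")
    case False
    with \<open>t \<le> f a\<close> have "0 \<le> sum c (insert a A)"
      using insert.prems(2)[of "f a"] superlevel_all[of "insert a A" "f a" f] least by simp
    with \<open>t \<le> f a\<close> show ?thesis by simp
  qed simp
  have "(\<Sum>x\<in>insert a A. c x * (f x - t)) =
      (\<Sum>x\<in>insert a A. c x * (f x - f a)) + sum c (insert a A) * (f a - t)"
    by (simp add: sum_distrib_right flip: sum.distrib) (simp add: algebra_simps)
  with above below show ?case by simp
qed

lemma mult_sum_le_sum_of_superlevel:
  fixes f :: "'b \<Rightarrow> 'c::linordered_idom" and m :: 'c
  assumes "finite A" "B \<subseteq> A" "\<And>x. x \<in> A \<Longrightarrow> 0 \<le> f x"
    and levels: "\<And>s. 0 < s \<Longrightarrow> m * of_nat (card (superlevel f s A)) \<le> of_nat (card (superlevel f s B))"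
  shows "m * sum f A \<le> sum f B"
proof -
  have indicator_sum: "(\<Sum>x\<in>A'. (of_bool (x \<in> B) - m) * g x) = sum g (A' \<inter> B) - m * sum g A'"
    if "A' \<subseteq> A" for A' and g :: "'b \<Rightarrow> 'c"
  proof -
    have "finite A'" using that assms(1) by (rule finite_subset)
    then have "(\<Sum>x\<in>A'. of_bool (x \<in> B) * g x) = sum g (A' \<inter> B)"
      by (auto simp: sum.inter_restrict intro!: sum.cong)
    then show ?thesis by (simp add: left_diff_distrib sum_subtractf sum_distrib_left)
  qed
  have "0 \<le> (\<Sum>x\<in>A. (of_bool (x \<in> B) - m) * (f x - 0))"
  proof (rule sum_mult_diff_nonneg_of_superlevel[OF assms(1,3)])
    fix s :: 'c assume "0 < s"
    have "superlevel f s A \<inter> B = superlevel f s B"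
      using assms(2) by (auto simp: superlevel_def)
    with levels[OF \<open>0 < s\<close>] indicator_sum[OF superlevel_subset[of f s A], of "\<lambda>_. 1"]
    show "0 \<le> (\<Sum>x\<in>superlevel f s A. of_bool (x \<in> B) - m)" by simp
  qed
  also have "\<dots> = sum f B - m * sum f A"
    using indicator_sum[of A f] assms(2) by (simp add: Int_absorb1)
  finally show ?thesis by simp
qed

subsection \<open>Sparse graphs\<close>

definition edge_ratio :: "'a ugraph \<Rightarrow> 'a set \<Rightarrow> real" where
  "edge_ratio G S = (real (card S) - 1) / real (num_edges (induced G S))"

definition sparse :: "real \<Rightarrow> 'a ugraph \<Rightarrow> bool" where
  "sparse m G \<longleftrightarrow> (\<forall>S\<in>Co G. m * num_edges (induced G S) \<le> real (card S) - 1)"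

lemma Co_finite_nonempty: "simple_graph G \<Longrightarrow> S \<in> Co G \<Longrightarrow> finite S \<and> S \<noteq> {}"
  by (auto simp: simple_graph_def Co_def connected_graph_def induced_def intro: finite_subset)

lemma sparseI:
  assumes G: "simple_graph G"
    and ratio: "\<And>S. S \<in> Co G \<Longrightarrow> 2 \<le> card S \<Longrightarrow> m \<le> edge_ratio G S"
  shows "sparse m G"
  unfolding sparse_def
proof
  fix S assume S: "S \<in> Co G"
  then have fin: "finite S" "S \<noteq> {}" using Co_finite_nonempty[OF G] by auto
  show "m * num_edges (induced G S) \<le> real (card S) - 1"
  proof (cases "2 \<le> card S")
    case True
    with ratio[OF S] show ?thesis
      by (cases "num_edges (induced G S) = 0") (auto simp: edge_ratio_def field_simps)
  next
    case False
    with fin have "card S = 1" by (cases "card S") auto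
    moreover have "e \<notin> edges (induced G S)" for e
      using G False card_mono[OF fin(1), of e] by (auto simp: induced_def simple_graph_def)
    then have "edges (induced G S) = {}" by blast
    ultimately show ?thesis by (simp add: num_edges_def)
  qed
qed

lemma quotient_reachable_subset_Co:
  assumes G: "simple_graph G" and F: "F \<subseteq> edges G"
  shows "verts G // reachable F \<subseteq> Co G"
proof
  fix C assume C: "C \<in> verts G // reachable F"
  have "F \<subseteq> [verts G]\<^bsup>2\<^esup>" using G F by (auto simp: simple_graph_iff)
  then have "partition_on (verts G) (verts G // reachable F)"
    by (rule partition_on_quotient_reachable)
  with C have "C \<subseteq> verts G" "C \<noteq> {}"
    by (auto simp: partition_on_def)
  moreover have "{e \<in> F. e \<subseteq> C} \<subseteq> {e \<in> edges G. e \<subseteq> C}" using F by blast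
  then have "(u, v) \<in> reachable {e \<in> edges G. e \<subseteq> C}" if "u \<in> C" "v \<in> C" for u v
    using reachable_within_component[OF C that] reachable_mono by blast
  ultimately show "C \<in> Co G"
    by (simp add: Co_def connected_graph_iff_reachable induced_def)
qed

lemma card_le_sum_num_edges_components:
  assumes G: "simple_graph G" and F: "F \<subseteq> edges G"
  shows "card F \<le> (\<Sum>C\<in>verts G // reachable F. num_edges (induced G C))"
proof -
  let ?Q = "verts G // reachable F"
  have fin: "finite (edges G)" "finite ?Q"
    using G by (simp_all add: simple_graph_finite_edges finite_quotient_reachable simple_graph_iff)
  have "e \<in> (\<Union>C\<in>?Q. edges (induced G C))" if "e \<in> F" for e
  proof -
    have "e \<in> [verts G]\<^bsup>2\<^esup>" using G F \<open>e \<in> F\<close> by (auto simp: simple_graph_iff)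
    then obtain u v where uv: "e = {u, v}" "u \<in> verts G" by (auto elim: nsets2_E)
    then have "e \<subseteq> reachable F `` {u}"
      using \<open>e \<in> F\<close> by (auto intro: edge_reachable)
    moreover have "reachable F `` {u} \<in> ?Q" using uv(2) by (rule quotientI)
    ultimately show ?thesis using \<open>e \<in> F\<close> F by (auto simp: induced_def)
  qed
  then have "card F \<le> card (\<Union>C\<in>?Q. edges (induced G C))"
    using fin by (intro card_mono) (auto simp: induced_def)
  also have "\<dots> \<le> (\<Sum>C\<in>?Q. num_edges (induced G C))"
    unfolding num_edges_def using fin(2) by (rule card_UN_le)
  finally show ?thesis .
qed

lemma sparse_mult_card_le:
  assumes G: "simple_graph G" and m: "sparse m G" "0 \<le> m" and F: "F \<subseteq> edges G"
  shows "m * card F \<le> real (card (verts G)) - real (card (verts G // reachable F))"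
proof -
  let ?Q = "verts G // reachable F"
  have FV: "F \<subseteq> [verts G]\<^bsup>2\<^esup>"
    using G F by (auto simp: simple_graph_iff)
  have Co: "?Q \<subseteq> Co G" using G F by (rule quotient_reachable_subset_Co)
  have "m * card F \<le> m * real (\<Sum>C\<in>?Q. num_edges (induced G C))"
    using card_le_sum_num_edges_components[OF G F] m(2) by (intro mult_left_mono of_nat_mono)
  also have "\<dots> = (\<Sum>C\<in>?Q. m * num_edges (induced G C))"
    by (simp add: sum_distrib_left)
  also have "\<dots> \<le> (\<Sum>C\<in>?Q. real (card C) - 1)"
    using m(1) Co by (intro sum_mono) (auto simp: sparse_def)
  also have "\<dots> = real (\<Sum>C\<in>?Q. card C) - real (card ?Q)"
    by (simp add: sum_subtractf)
  also have "(\<Sum>C\<in>?Q. card C) = card (verts G)"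
    by (rule product_partition[OF partition_on_quotient_reachable[OF FV], symmetric])
      (use Co Co_finite_nonempty[OF G] in blast)
  finally show ?thesis .
qed

subsection \<open>The weighting ratio\<close>

lemma exists_heavy_spanning_tree:
  assumes G: "simple_graph G" "connected_graph G"
    and m: "sparse m G" "0 \<le> m" and \<omega>: "\<And>e. e \<in> edges G \<Longrightarrow> 0 \<le> \<omega> e"
  shows "\<exists>T. is_spanning_tree G T \<and> m * weight \<omega> G \<le> weight \<omega> T"
proof -
  obtain T where T: "is_spanning_tree G T"
    and levels: "\<And>s. reachable (superlevel \<omega> s (edges T)) = reachable (superlevel \<omega> s (edges G))"
    using exists_kruskal_tree[OF G] by metis
  have sub: "edges T \<subseteq> edges G" using T by (simp add: is_spanning_tree_def)
  have "m * card (superlevel \<omega> s (edges G)) \<le> card (superlevel \<omega> s (edges T))" for s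
  proof -
    have "m * card (superlevel \<omega> s (edges G)) \<le>
        real (card (verts G)) - card (verts G // reachable (superlevel \<omega> s (edges G)))"
      using G(1) m superlevel_subset by (rule sparse_mult_card_le)
    also have "\<dots> = real (card (verts G)) - card (verts G // reachable (superlevel \<omega> s (edges T)))"
      by (simp only: levels)
    also have "\<dots> \<le> card (superlevel \<omega> s (edges T))"
      using card_vertices_le_edges_plus_components[of "verts G" "superlevel \<omega> s (edges T)"] G(1) sub
        superlevel_subset[of \<omega> s "edges T"]
      by (fastforce simp: simple_graph_iff)
    finally show ?thesis .
  qed
  then have "m * weight \<omega> G \<le> weight \<omega> T"
    unfolding weight_def
    using mult_sum_le_sum_of_superlevel[OF simple_graph_finite_edges[OF G(1)] sub, of \<omega> m] \<omega>
    by simp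
  with T show ?thesis by blast
qed

lemma is_max_spanning_tree_max_spanning_tree:
  assumes G: "simple_graph G" "connected_graph G"
  shows "is_max_spanning_tree G \<omega> (max_spanning_tree G \<omega>)"
proof -
  let ?W = "weight \<omega> ` {T. is_spanning_tree G T}"
  have "?W \<subseteq> sum \<omega> ` Pow (edges G)"
    by (auto simp: is_spanning_tree_def weight_def)
  then have fin: "finite ?W"
    using simple_graph_finite_edges[OF G(1)] by (simp add: finite_subset)
  have "?W \<noteq> {}"
    using exists_kruskal_tree[OF G] by blast
  with fin have "Max ?W \<in> ?W" by (rule Max_in)
  then obtain T where "is_spanning_tree G T" "weight \<omega> T = Max ?W" by auto
  with fin have "is_max_spanning_tree G \<omega> T" by (simp add: is_max_spanning_tree_def)
  then show ?thesis unfolding max_spanning_tree_def by (rule someI)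
qed

lemma weight_pos:
  assumes "simple_graph G" "\<omega> \<in> weightings G"
  shows "0 < weight \<omega> G"
proof -
  obtain e where "e \<in> edges G" "0 < \<omega> e" and "\<forall>e\<in>edges G. 0 \<le> \<omega> e"
    using assms(2) by (force simp: weightings_def)
  with simple_graph_finite_edges[OF assms(1)] show ?thesis
    unfolding weight_def by (auto intro: sum_pos2)
qed

lemma sparse_le_weighting_ratio:
  assumes G: "simple_graph G" "connected_graph G" and m: "sparse m G" "0 \<le> m"
    and \<omega>: "\<omega> \<in> weightings G"
  shows "m \<le> weighting_ratio G \<omega>"
proof -
  obtain T where "is_spanning_tree G T" "m * weight \<omega> G \<le> weight \<omega> T"
    using exists_heavy_spanning_tree[OF G m, of \<omega>] \<omega> by (auto simp: weightings_def)
  then have "m * weight \<omega> G \<le> weight \<omega> (max_spanning_tree G \<omega>)"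
    using is_max_spanning_tree_max_spanning_tree[OF G, of \<omega>]
    unfolding is_max_spanning_tree_def by (meson order_trans)
  with weight_pos[OF G(1) \<omega>] show ?thesis
    by (simp add: weighting_ratio_def pos_le_divide_eq)
qed

definition indicator_weight :: "'a set \<Rightarrow> 'a set \<Rightarrow> real" where
  "indicator_weight S e = of_bool (e \<subseteq> S)"

lemma weight_indicator_weight:
  "finite (edges H) \<Longrightarrow> weight (indicator_weight S) H = card {e \<in> edges H. e \<subseteq> S}"
  by (simp add: weight_def indicator_weight_def sum_of_bool_eq Int_def)

lemma indicator_weight_in_weightings:
  assumes S: "S \<in> Co G" "2 \<le> card S"
  shows "indicator_weight S \<in> weightings G"
proof -
  obtain u v where "u \<in> S" "v \<in> S" "u \<noteq> v"
    using S(2) by (meson card_2_iff' obtain_subset_with_card_n subsetD)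
  moreover have "(u, v) \<in> reachable {e \<in> edges G. e \<subseteq> S}" if "u \<in> S" "v \<in> S" for u v
    using S(1) that by (simp add: Co_def connected_graph_iff_reachable induced_def)
  ultimately have "{e \<in> edges G. e \<subseteq> S} \<noteq> {}"
    using reachable_empty by (metis pair_in_Id_conv)
  then show ?thesis by (auto simp: weightings_def indicator_weight_def)
qed

lemma weighting_ratio_indicator_weight_le:
  assumes G: "simple_graph G" "connected_graph G" and S: "finite S" "S \<noteq> {}"
  shows "weighting_ratio G (indicator_weight S) \<le> edge_ratio G S"
proof -
  let ?T = "max_spanning_tree G (indicator_weight S)"
  have T: "is_spanning_tree G ?T"
    using is_max_spanning_tree_max_spanning_tree[OF G] by (simp add: is_max_spanning_tree_def)
  then have "finite (edges ?T)"
    using simple_graph_finite_edges by (auto simp: is_spanning_tree_def is_tree_def)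
  then have "weight (indicator_weight S) ?T \<le> real (card S) - 1"
    using is_spanning_tree_card_less[OF T S] by (simp add: weight_indicator_weight)
  moreover have "weight (indicator_weight S) G = num_edges (induced G S)"
    using simple_graph_finite_edges[OF G(1)]
    by (simp add: weight_indicator_weight num_edges_def induced_def)
  ultimately show ?thesis
    by (simp add: weighting_ratio_def edge_ratio_def divide_right_mono)
qed

lemma finite_Co: "simple_graph G \<Longrightarrow> finite (Co G)"
  by (auto simp: Co_def simple_graph_def)

lemma verts_in_Co:
  assumes "simple_graph G" "connected_graph G"
  shows "verts G \<in> Co G"
proof -
  have "{e \<in> edges G. e \<subseteq> verts G} = edges G"
    using assms(1) by (auto simp: simple_graph_def)
  with assms(2) show ?thesis
    by (simp add: Co_def connected_graph_iff_reachable induced_def)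
qed

lemma two_le_card_verts:
  assumes "simple_graph G" "edges G \<noteq> {}"
  shows "2 \<le> card (verts G)"
proof -
  obtain e where "e \<subseteq> verts G" "card e = 2" "finite (verts G)"
    using assms by (auto simp: simple_graph_def)
  then show ?thesis using card_mono by metis
qed

theorem theorem3:
  fixes G :: "'a ugraph"
  assumes "simple_graph G" and "connected_graph G" and "edges G \<noteq> {}"
  shows "(INF \<omega>\<in>weightings G. weighting_ratio G \<omega>) =
    Min ((\<lambda>S. (real (card S) - 1) / real (num_edges (induced G S))) ` {S \<in> Co G. 2 \<le> card S})"
proof -
  let ?R = "edge_ratio G ` {S \<in> Co G. 2 \<le> card S}"
  have fin: "finite ?R" using finite_Co[OF assms(1)] by simp
  have "?R \<noteq> {}" using verts_in_Co[OF assms(1,2)] two_le_card_verts[OF assms(1,3)] by blast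
  with fin have "Min ?R \<in> ?R" by (rule Min_in)
  then obtain S where S: "S \<in> Co G" "2 \<le> card S" and min: "Min ?R = edge_ratio G S" by blast
  have "sparse (Min ?R) G" using assms(1) fin by (intro sparseI Min_le) auto
  moreover have "0 \<le> Min ?R" using S(2) by (simp only: min) (simp add: edge_ratio_def)
  ultimately have lower: "Min ?R \<le> weighting_ratio G \<omega>" if "\<omega> \<in> weightings G" for \<omega>
    using that by (rule sparse_le_weighting_ratio[OF assms(1,2)])
  have indicator: "indicator_weight S \<in> weightings G"
    using S by (rule indicator_weight_in_weightings)
  have "weighting_ratio G (indicator_weight S) \<le> Min ?R"
    using weighting_ratio_indicator_weight_le[OF assms(1,2)] Co_finite_nonempty[OF assms(1) S(1)]
    by (simp add: min)
  with lower[OF indicator] have "Min ?R = weighting_ratio G (indicator_weight S)"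
    by (rule antisym)
  then have "(INF \<omega>\<in>weightings G. weighting_ratio G \<omega>) = Min ?R"
    using indicator lower by (intro cInf_eq_minimum) auto
  then show ?thesis by (simp only: edge_ratio_def[abs_def])
qed

end
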